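(* For any set $\Gamma$ of formulas of intuitionistic propositional logic and any formula $\varphi$, $$\Gamma\vdash\varphi \quad\text{if and only if}\quad \Gamma\vDash\varphi,$$ where $\Gamma\vdash\varphi$ is derivability from $\Gamma$ in the Hilbert-style proof system described in the context and $\Gamma\vDash\varphi$ is local semantic consequence over Kripke models.
   Context: Formulas: built from a countable set of propositional variables indexed by natural numbers ($Var=\{p_n : n\in\mathbb{N}\}$) and $\bot$ by the binary connectives $\wedge,\vee,\to$ ($\wedge,\vee$ bind more strongly than $\to$, which associates to the right). Proof system: for a set $\Gamma$ of formulas, $\Gamma\vdash\varphi$ is defined inductively. Base cases: $\Gamma\vdash\varphi$ for $\varphi\in\Gamma$; and for all formulas $\varphi,\psi$ the axioms $\varphi\vee\varphi\to\varphi$; $\varphi\to\varphi\wedge\varphi$; $\varphi\to\varphi\vee\psi$; $\varphi\wedge\psi\to\varphi$; $\varphi\vee\psi\to\psi\vee\varphi$; $\varphi\wedge\psi\to\psi\wedge\varphi$; $\bot\to\varphi$. Rules (for all $\varphi,\psi,\chi$): from $\Gamma\vdash\varphi$ and $\Gamma\vdash\varphi\to\psi$ infer $\Gamma\vdash\psi$; from $\Gamma\vdash\varphi\to\psi$ and $\Gamma\vdash\psi\to\chi$ infer $\Gamma\vdash\varphi\to\chi$; from $\Gamma\vdash\varphi\wedge\psi\to\chi$ infer $\Gamma\vdash\varphi\to(\psi\to\chi)$; from $\Gamma\vdash\varphi\to(\psi\to\chi)$ infer $\Gamma\vdash\varphi\wedge\psi\to\chi$; from $\Gamma\vdash\varphi\to\psi$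 infer $\Gamma\vdash\chi\vee\varphi\to\chi\vee\psi$. Kripke semantics: a Kripke model is $M=(W,R,V)$ with $W$ a non-empty set, $R$ a reflexive and transitive binary relation on $W$, and $V:Var\times W\to\{0,1\}$ such that $V(p,w)=1$ and $Rww'$ imply $V(p,w')=1$. Truth at a world: $M,w\vDash p$ iff $V(p,w)=1$; $M,w\not\vDash\bot$; $M,w\vDash\varphi\wedge\psi$ iff both hold at $w$; $M,w\vDash\varphi\vee\psi$ iff at least one holds at $w$; $M,w\vDash\varphi\to\psi$ iff for all $w'$ with $Rww'$ and $M,w'\vDash\varphi$ one has $M,w'\vDash\psi$. $M,w\vDash\Gamma$ means $M,w\vDash\varphi$ for all $\varphi\in\Gamma$. Local semantic consequence $\Gamma\vDash\varphi$ means: for all Kripke models $M$ and all worlds $w$ of $M$, $M,w\vDash\Gamma$ implies $M,w\vDash\varphi$. *)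

theory Defs
  imports Main
begin

datatype form =
    Var nat
  | Bot  ("\<^bold>\<bottom>")
  | Conj form form  (infixr "\<^bold>\<and>" 75)
  | Disj form form  (infixr "\<^bold>\<or>" 75)
  | Imp form form  (infixr "\<^bold>\<rightarrow>" 65)

inductive derivable :: "form set \<Rightarrow> form \<Rightarrow> bool"  (infix "\<turnstile>" 50)
  for \<Gamma> :: "form set"
where
  Hyp: "\<phi> \<in> \<Gamma> \<Longrightarrow> \<Gamma> \<turnstile> \<phi>"
| DisjContr: "\<Gamma> \<turnstile> (\<phi> \<^bold>\<or> \<phi>) \<^bold>\<rightarrow> \<phi>"
| ConjContr: "\<Gamma> \<turnstile> \<phi> \<^bold>\<rightarrow> (\<phi> \<^bold>\<and> \<phi>)"
| DisjWeak: "\<Gamma> \<turnstile> \<phi> \<^bold>\<rightarrow> (\<phi> \<^bold>\<or> \<psi>)"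
| ConjWeak: "\<Gamma> \<turnstile> (\<phi> \<^bold>\<and> \<psi>) \<^bold>\<rightarrow> \<phi>"
| DisjPerm: "\<Gamma> \<turnstile> (\<phi> \<^bold>\<or> \<psi>) \<^bold>\<rightarrow> (\<psi> \<^bold>\<or> \<phi>)"
| ConjPerm: "\<Gamma> \<turnstile> (\<phi> \<^bold>\<and> \<psi>) \<^bold>\<rightarrow> (\<psi> \<^bold>\<and> \<phi>)"
| ExFalso: "\<Gamma> \<turnstile> \<^bold>\<bottom> \<^bold>\<rightarrow> \<phi>"
| ModusPonens: "\<lbrakk>\<Gamma> \<turnstile> \<phi>; \<Gamma> \<turnstile> \<phi> \<^bold>\<rightarrow> \<psi>\<rbrakk> \<Longrightarrow> \<Gamma> \<turnstile> \<psi>"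
| Syllogism: "\<lbrakk>\<Gamma> \<turnstile> \<phi> \<^bold>\<rightarrow> \<psi>; \<Gamma> \<turnstile> \<psi> \<^bold>\<rightarrow> \<chi>\<rbrakk> \<Longrightarrow> \<Gamma> \<turnstile> \<phi> \<^bold>\<rightarrow> \<chi>"
| Exportation: "\<Gamma> \<turnstile> (\<phi> \<^bold>\<and> \<psi>) \<^bold>\<rightarrow> \<chi> \<Longrightarrow> \<Gamma> \<turnstile> \<phi> \<^bold>\<rightarrow> (\<psi> \<^bold>\<rightarrow> \<chi>)"
| Importation: "\<Gamma> \<turnstile> \<phi> \<^bold>\<rightarrow> (\<psi> \<^bold>\<rightarrow> \<chi>) \<Longrightarrow> \<Gamma> \<turnstile> (\<phi> \<^bold>\<and> \<psi>) \<^bold>\<rightarrow> \<chi>"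
| Expansion: "\<Gamma> \<turnstile> \<phi> \<^bold>\<rightarrow> \<psi> \<Longrightarrow> \<Gamma> \<turnstile> (\<chi> \<^bold>\<or> \<phi>) \<^bold>\<rightarrow> (\<chi> \<^bold>\<or> \<psi>)"

text \<open>The worlds form an arbitrary non-empty subset of the type \<open>'w\<close>. Since
  \<^const>\<open>preorder_on\<close> includes \<open>R \<subseteq> W \<times> W\<close>, successors of worlds are worlds, and the
  values of \<open>V\<close> outside \<open>W\<close> are irrelevant.\<close>

record 'w kripke =
  worlds :: "'w set"
  acc :: "'w rel"
  val :: "nat \<Rightarrow> 'w \<Rightarrow> bool"

definition kripke_model :: "'w kripke \<Rightarrow> bool" where
  "kripke_model M \<longleftrightarrow>
     worlds M \<noteq> {} \<and>
     preorder_on (worlds M) (acc M) \<and>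
     (\<forall>n w w'. val M n w \<and> (w, w') \<in> acc M \<longrightarrow> val M n w')"

primrec truth :: "'w kripke \<Rightarrow> 'w \<Rightarrow> form \<Rightarrow> bool"  ("_, _ \<Turnstile> _" [51, 51, 51] 50) where
  "(M, w \<Turnstile> Var n) \<longleftrightarrow> val M n w"
| "(M, w \<Turnstile> \<^bold>\<bottom>) \<longleftrightarrow> False"
| "(M, w \<Turnstile> \<phi> \<^bold>\<and> \<psi>) \<longleftrightarrow> (M, w \<Turnstile> \<phi>) \<and> (M, w \<Turnstile> \<psi>)"
| "(M, w \<Turnstile> \<phi> \<^bold>\<or> \<psi>) \<longleftrightarrow> (M, w \<Turnstile> \<phi>) \<or> (M, w \<Turnstile> \<psi>)"
| "(M, w \<Turnstile> \<phi> \<^bold>\<rightarrow> \<psi>) \<longleftrightarrow> (\<forall>w'. (w, w') \<in> acc M \<and> (M, w' \<Turnstile> \<phi>) \<longrightarrow> (M, w' \<Turnstile> \<psi>))"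

text \<open>HOL cannot quantify over types inside a formula, so local consequence carries the type
  from which worlds are drawn as an explicit parameter.\<close>

definition consequence :: "'w itself \<Rightarrow> form set \<Rightarrow> form \<Rightarrow> bool" where
  "consequence _ \<Gamma> \<phi> \<longleftrightarrow>
     (\<forall>M :: 'w kripke. kripke_model M \<longrightarrow>
       (\<forall>w \<in> worlds M. (\<forall>\<psi> \<in> \<Gamma>. M, w \<Turnstile> \<psi>) \<longrightarrow> (M, w \<Turnstile> \<phi>)))"

abbreviation consequence_syntax :: "form set \<Rightarrow> 'w itself \<Rightarrow> form \<Rightarrow> bool"
    ("_ \<Turnstile>\<^bsub>_\<^esub> _" [51, 0, 51] 50) where
  "\<Gamma> \<Turnstile>\<^bsub>T\<^esub> \<phi> \<equiv> consequence T \<Gamma> \<phi>"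

end

(* Soundness is a rule induction, using persistence of truth along the accessibility relation.
   For completeness, the calculus satisfies the deduction theorem, so a set maximal among those
   not deriving a given formula is a prime theory.  The prime theories, ordered by inclusion,
   form a model in which truth is membership; if \<phi> is not derivable from \<Gamma>, then some prime
   theory containing \<Gamma> omits \<phi> and is a world refuting the consequence. *)
theory Submission
  imports Defs
begin

section \<open>Soundness\<close>

text \<open>Atoms persist by the condition on the valuation, and implications by transitivity, since
  every successor of \<open>w'\<close> is one of \<open>w\<close>.\<close>

lemma truth_persistent:
  assumes "kripke_model M" "(w, w') \<in> acc M" "M, w \<Turnstile> \<phi>"
  shows "M, w' \<Turnstile> \<phi>"
  using assms(2,3)
proof (induction \<phi> arbitrary: w w')
  case (Var n)
  then show ?case using assms(1) by (auto simp: kripke_model_def)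
next
  case (Imp \<phi> \<psi>)
  have "trans (acc M)"
    using assms(1) by (simp add: kripke_model_def preorder_on_def)
  then show ?case using Imp.prems by (auto dest: transD)
qed auto

text \<open>The rule induction runs at one fixed world, because local consequence assumes
  \<open>\<Gamma>\<close> only at \<open>w\<close>.\<close>

lemma soundness:
  assumes "\<Gamma> \<turnstile> \<phi>"
  shows "\<Gamma> \<Turnstile>\<^bsub>TYPE('w)\<^esub> \<phi>"
  unfolding consequence_def
proof (intro allI impI ballI)
  fix M :: "'w kripke" and w
  assume M: "kripke_model M" and w: "w \<in> worlds M" "\<forall>\<psi>\<in>\<Gamma>. M, w \<Turnstile> \<psi>"
  have sub: "acc M \<subseteq> worlds M \<times> worlds M"
    and refl: "\<And>v. v \<in> worlds M \<Longrightarrow> (v, v) \<in> acc M"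
    and trans: "\<And>u v x. (u, v) \<in> acc M \<Longrightarrow> (v, x) \<in> acc M \<Longrightarrow> (u, x) \<in> acc M"
    using M by (auto simp: kripke_model_def preorder_on_def refl_on_def dest: transD)
  note pers = truth_persistent[OF M]
  show "M, w \<Turnstile> \<phi>"
    using assms
  proof induction
    case (Hyp \<phi>)
    then show ?case using w(2) by blast
  next
    case (ModusPonens \<phi> \<psi>)
    then show ?case using refl[OF w(1)] by auto
  next
    case (Exportation \<phi> \<psi> \<chi>)
    \<comment> \<open>Given \<open>\<phi>\<close> at a successor \<open>v\<close> of
      \<open>w\<close> and \<open>\<psi>\<close> at a successor \<open>x\<close> of
      \<open>v\<close>, persistence carries \<open>\<phi>\<close> up to \<open>x\<close>, which
      transitivity puts above \<open>w\<close>.\<close>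
    then show ?case using trans pers by (simp, blast)
  next
    case (Importation \<phi> \<psi> \<chi>)
    have "M, v \<Turnstile> \<chi>" if v: "(w, v) \<in> acc M" "M, v \<Turnstile> \<phi>" "M, v \<Turnstile> \<psi>" for v
    proof -
      \<comment> \<open>The inner implication, true at \<open>v\<close>, is applied at
        \<open>v\<close> itself.\<close>
      have "(v, v) \<in> acc M" using v(1) sub refl by blast
      then show ?thesis using Importation.IH v by auto
    qed
    then show ?case by simp
  qed auto
qed

section \<open>The deduction theorem\<close>

lemmas axioms = DisjContr ConjContr DisjWeak ConjWeak DisjPerm ConjPerm ExFalso

lemma derivable_mono:
  assumes "\<Gamma> \<turnstile> \<phi>" "\<Gamma> \<subseteq> \<Delta>"
  shows "\<Delta> \<turnstile> \<phi>"
  using assms(1)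
proof induction
  case (Hyp \<phi>)
  then show ?case using assms(2) by (blast intro: derivable.Hyp)
next
  case (ModusPonens \<phi> \<psi>)
  show ?case by (rule derivable.ModusPonens[OF ModusPonens.IH])
next
  case (Syllogism \<phi> \<psi> \<chi>)
  show ?case by (rule derivable.Syllogism[OF Syllogism.IH])
qed (rule axioms Exportation Importation Expansion; assumption?)+

lemma imp_refl: "\<Gamma> \<turnstile> \<phi> \<^bold>\<rightarrow> \<phi>"
  by (rule Syllogism[OF DisjWeak DisjContr])

lemma imp_const: "\<Gamma> \<turnstile> \<phi> \<^bold>\<rightarrow> (\<psi> \<^bold>\<rightarrow> \<phi>)"
  by (rule Exportation[OF ConjWeak])

lemma imp_weaken: "\<Gamma> \<turnstile> \<psi> \<Longrightarrow> \<Gamma> \<turnstile> \<phi> \<^bold>\<rightarrow> \<psi>"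
  by (rule ModusPonens[OF _ imp_const])

lemma conj_weak_right: "\<Gamma> \<turnstile> (\<phi> \<^bold>\<and> \<psi>) \<^bold>\<rightarrow> \<psi>"
  by (rule Syllogism[OF ConjPerm ConjWeak])

lemma disj_weak_right: "\<Gamma> \<turnstile> \<psi> \<^bold>\<rightarrow> (\<phi> \<^bold>\<or> \<psi>)"
  by (rule Syllogism[OF DisjWeak DisjPerm])

lemma imp_swap: "\<Gamma> \<turnstile> \<phi> \<^bold>\<rightarrow> (\<psi> \<^bold>\<rightarrow> \<chi>) \<Longrightarrow> \<Gamma> \<turnstile> \<psi> \<^bold>\<rightarrow> (\<phi> \<^bold>\<rightarrow> \<chi>)"
  by (rule Exportation[OF Syllogism[OF ConjPerm Importation]])

text \<open>Modus ponens under a hypothesis \<open>\<phi>\<close>: swapping and composing yields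
  \<open>\<phi>\<close> implies (\<open>\<phi>\<close> implies \<open>\<chi>\<close>), and
  contraction merges the two copies of \<open>\<phi>\<close>.\<close>

lemma imp_mp:
  assumes "\<Gamma> \<turnstile> \<phi> \<^bold>\<rightarrow> \<psi>" "\<Gamma> \<turnstile> \<phi> \<^bold>\<rightarrow> (\<psi> \<^bold>\<rightarrow> \<chi>)"
  shows "\<Gamma> \<turnstile> \<phi> \<^bold>\<rightarrow> \<chi>"
  by (rule Syllogism[OF ConjContr Importation[OF Syllogism[OF assms(1) imp_swap[OF assms(2)]]]])

lemma imp_conj:
  assumes "\<Gamma> \<turnstile> \<phi> \<^bold>\<rightarrow> \<psi>" "\<Gamma> \<turnstile> \<phi> \<^bold>\<rightarrow> \<chi>"
  shows "\<Gamma> \<turnstile> \<phi> \<^bold>\<rightarrow> (\<psi> \<^bold>\<and> \<chi>)"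
  by (rule imp_mp[OF assms(2) Syllogism[OF assms(1) Exportation[OF imp_refl]]])

text \<open>\<open>Expansion\<close> rewrites only the right disjunct, so \<open>\<psi>\<close>
  becomes \<open>\<chi>\<close>, the disjuncts are permuted, \<open>\<phi>\<close> becomes
  \<open>\<chi>\<close>, and the two copies of \<open>\<chi>\<close> are contracted.\<close>

lemma disj_imp:
  assumes "\<Gamma> \<turnstile> \<phi> \<^bold>\<rightarrow> \<chi>" "\<Gamma> \<turnstile> \<psi> \<^bold>\<rightarrow> \<chi>"
  shows "\<Gamma> \<turnstile> (\<phi> \<^bold>\<or> \<psi>) \<^bold>\<rightarrow> \<chi>"
proof -
  have "\<Gamma> \<turnstile> (\<phi> \<^bold>\<or> \<psi>) \<^bold>\<rightarrow> (\<chi> \<^bold>\<or> \<phi>)"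
    by (rule Syllogism[OF Expansion[OF assms(2)] DisjPerm])
  then show ?thesis
    by (rule Syllogism[OF _ Syllogism[OF Expansion[OF assms(1)] DisjContr]])
qed

text \<open>Each rule has a version relative to \<open>\<alpha>\<close>, obtained by importing
  \<open>\<alpha>\<close> into a conjunctive antecedent, reasoning there, and exporting it
  again.\<close>

theorem deduction: "insert \<alpha> \<Gamma> \<turnstile> \<phi> \<Longrightarrow> \<Gamma> \<turnstile> \<alpha> \<^bold>\<rightarrow> \<phi>"
proof (induction rule: derivable.induct)
  case (Hyp \<phi>)
  then show ?case by (auto intro: imp_refl imp_weaken derivable.Hyp)
next
  case (ModusPonens \<phi> \<psi>)
  show ?case by (rule imp_mp[OF ModusPonens.IH])
next
  case (Syllogism \<phi> \<psi> \<chi>)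
  have "\<Gamma> \<turnstile> (\<alpha> \<^bold>\<and> \<phi>) \<^bold>\<rightarrow> \<chi>"
    by (rule imp_mp[OF Importation[OF Syllogism.IH(1)]
          derivable.Syllogism[OF ConjWeak Syllogism.IH(2)]])
  then show ?case by (rule Exportation)
next
  case (Exportation \<phi> \<psi> \<chi>)
  \<comment> \<open>Conjunction is reassociated so that the imported induction hypothesis fits; the
    importation case does the converse.\<close>
  have "\<Gamma> \<turnstile> ((\<alpha> \<^bold>\<and> \<phi>) \<^bold>\<and> \<psi>) \<^bold>\<rightarrow> (\<alpha> \<^bold>\<and> (\<phi> \<^bold>\<and> \<psi>))"
    by (intro imp_conj conj_weak_right Syllogism[OF ConjWeak ConjWeak]
        Syllogism[OF ConjWeak conj_weak_right])
  then have "\<Gamma> \<turnstile> ((\<alpha> \<^bold>\<and> \<phi>) \<^bold>\<and> \<psi>) \<^bold>\<rightarrow> \<chi>"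
    by (rule Syllogism[OF _ Importation[OF Exportation.IH]])
  then show ?case by (intro derivable.Exportation)
next
  case (Importation \<phi> \<psi> \<chi>)
  have "\<Gamma> \<turnstile> (\<alpha> \<^bold>\<and> (\<phi> \<^bold>\<and> \<psi>)) \<^bold>\<rightarrow> ((\<alpha> \<^bold>\<and> \<phi>) \<^bold>\<and> \<psi>)"
    by (intro imp_conj ConjWeak Syllogism[OF conj_weak_right ConjWeak]
        Syllogism[OF conj_weak_right conj_weak_right])
  then have "\<Gamma> \<turnstile> (\<alpha> \<^bold>\<and> (\<phi> \<^bold>\<and> \<psi>)) \<^bold>\<rightarrow> \<chi>"
    by (rule Syllogism[OF _ derivable.Importation[OF derivable.Importation[OF Importation.IH]]])
  then show ?case by (rule Exportation)
next
  case (Expansion \<phi> \<psi> \<chi>)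
  \<comment> \<open>With \<open>\<alpha>\<close> moved into the conclusion, the claim becomes a case
    distinction on the disjunction; a final swap restores the order.\<close>
  have "\<Gamma> \<turnstile> \<chi> \<^bold>\<rightarrow> (\<alpha> \<^bold>\<rightarrow> (\<chi> \<^bold>\<or> \<psi>))"
    by (rule Syllogism[OF DisjWeak imp_const])
  moreover have "\<Gamma> \<turnstile> \<phi> \<^bold>\<rightarrow> (\<alpha> \<^bold>\<rightarrow> (\<chi> \<^bold>\<or> \<psi>))"
    by (rule imp_swap[OF Exportation[OF Syllogism[OF Importation[OF Expansion.IH] disj_weak_right]]])
  ultimately show ?case by (intro imp_swap[OF disj_imp])
qed (rule imp_weaken, rule axioms)+

section \<open>Prime theories and completeness\<close>

text \<open>Compactness along a chain, needed for Zorn's lemma. In a rule with two premises, the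
  larger of the two chain members derives both; nonemptiness of \<open>C\<close> serves the
  axioms.\<close>

lemma derivable_Union_chain:
  assumes "\<Union>C \<turnstile> \<phi>" "C \<noteq> {}" "subset.chain A C"
  shows "\<exists>\<Gamma>\<in>C. \<Gamma> \<turnstile> \<phi>"
proof -
  have common: "\<exists>\<Gamma>\<in>C. \<Gamma> \<turnstile> \<phi> \<and> \<Gamma> \<turnstile> \<psi>"
    if "\<exists>\<Gamma>\<in>C. \<Gamma> \<turnstile> \<phi>" "\<exists>\<Gamma>\<in>C. \<Gamma> \<turnstile> \<psi>" for \<phi> \<psi>
  proof -
    from that obtain X Y where "X \<in> C" "X \<turnstile> \<phi>" "Y \<in> C" "Y \<turnstile> \<psi>" by blast
    moreover from this have "X \<subseteq> Y \<or> Y \<subseteq> X"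
      using assms(3) by (auto simp: subset_chain_def)
    ultimately show ?thesis using derivable_mono by blast
  qed
  show ?thesis
    using assms(1)
  proof induction
    case (ModusPonens \<phi> \<psi>)
    then show ?case using common[OF ModusPonens.IH] derivable.ModusPonens by blast
  next
    case (Syllogism \<phi> \<psi> \<chi>)
    then show ?case using common[OF Syllogism.IH] derivable.Syllogism by blast
  qed (use assms(2) in \<open>auto intro: Hyp axioms Exportation Importation Expansion\<close>)
qed

definition prime_theory :: "form set \<Rightarrow> bool" where
  "prime_theory \<Delta> \<longleftrightarrow>
     (\<forall>\<phi>. \<Delta> \<turnstile> \<phi> \<longrightarrow> \<phi> \<in> \<Delta>) \<and> \<^bold>\<bottom> \<notin> \<Delta> \<and>
     (\<forall>\<phi> \<psi>. (\<phi> \<^bold>\<or> \<psi>) \<in> \<Delta> \<longrightarrow> \<phi> \<in> \<Delta> \<or> \<psi> \<in> \<Delta>)"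

text \<open>Zorn's lemma gives a maximal set among those that contain \<open>\<Gamma>\<close> and do
  not derive \<open>\<phi>\<close>; maximality makes it closed and prime.\<close>

lemma prime_extension:
  assumes "\<not> \<Gamma> \<turnstile> \<phi>"
  obtains \<Delta> where "\<Gamma> \<subseteq> \<Delta>" "prime_theory \<Delta>" "\<phi> \<notin> \<Delta>"
proof -
  let ?A = "{\<Delta>. \<Gamma> \<subseteq> \<Delta> \<and> \<not> \<Delta> \<turnstile> \<phi>}"
  have "\<Union>C \<in> ?A" if C: "C \<noteq> {}" "subset.chain ?A C" for C
  proof -
    have "C \<subseteq> ?A" using C(2) by (simp add: subset_chain_def)
    then show ?thesis using C derivable_Union_chain[of C \<phi> ?A] by blast
  qed
  moreover have "?A \<noteq> {}" using assms by blast
  ultimately have "\<exists>\<Delta>\<in>?A. \<forall>X\<in>?A. \<Delta> \<subseteq> X \<longrightarrow> X = \<Delta>"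
    by (intro subset_Zorn_nonempty)
  then obtain \<Delta> where \<Delta>: "\<Delta> \<in> ?A" and max: "\<forall>X\<in>?A. \<Delta> \<subseteq> X \<longrightarrow> X = \<Delta>"
    by (rule bexE)
  have nd: "\<not> \<Delta> \<turnstile> \<phi>" using \<Delta> by simp
  \<comment> \<open>Adding a formula outside \<open>\<Delta>\<close> must make \<open>\<phi>\<close>
    derivable, by maximality; the deduction theorem turns this into an implication.\<close>
  have imp: "\<Delta> \<turnstile> \<psi> \<^bold>\<rightarrow> \<phi>" if "\<psi> \<notin> \<Delta>" for \<psi>
  proof (rule ccontr)
    assume "\<not> \<Delta> \<turnstile> \<psi> \<^bold>\<rightarrow> \<phi>"
    then have "insert \<psi> \<Delta> \<in> ?A" using \<Delta> deduction by blast
    then show False using max that by blast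
  qed
  have closed: "\<psi> \<in> \<Delta>" if "\<Delta> \<turnstile> \<psi>" for \<psi>
    using imp ModusPonens[OF that] nd by blast
  \<comment> \<open>If both disjuncts were missing, each would imply \<open>\<phi>\<close>, and so
    would their disjunction.\<close>
  have "\<psi> \<in> \<Delta> \<or> \<chi> \<in> \<Delta>" if "(\<psi> \<^bold>\<or> \<chi>) \<in> \<Delta>" for \<psi> \<chi>
    using ModusPonens[OF Hyp[OF that] disj_imp] imp nd by blast
  moreover have "\<^bold>\<bottom> \<notin> \<Delta>"
    using ModusPonens[OF Hyp ExFalso] nd by blast
  ultimately have "prime_theory \<Delta>" using closed by (simp add: prime_theory_def)
  moreover have "\<phi> \<notin> \<Delta>" using Hyp nd by blast
  ultimately show thesis using \<Delta> that by blast
qed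

text \<open>Inclusion is restricted to prime theories because \<open>preorder_on\<close> requires
  the relation to lie within the set of worlds.\<close>

definition canonical_model :: "form set kripke" where
  "canonical_model =
     \<lparr>worlds = {\<Delta>. prime_theory \<Delta>},
      acc = {(\<Delta>, \<Theta>). prime_theory \<Delta> \<and> prime_theory \<Theta> \<and> \<Delta> \<subseteq> \<Theta>},
      val = (\<lambda>n \<Delta>. Var n \<in> \<Delta>)\<rparr>"

text \<open>The hypothesis supplies a world, as a model must be non-empty.\<close>

lemma kripke_model_canonical:
  assumes "prime_theory \<Delta>"
  shows "kripke_model canonical_model"
  using assms
  by (auto simp: kripke_model_def canonical_model_def preorder_on_def refl_on_def trans_def)

text \<open>Closure and primeness match the clauses for the connectives. \<open>\<Delta>\<close> is
  generalised because implication refers to larger theories.\<close>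

lemma truth_canonical:
  "prime_theory \<Delta> \<Longrightarrow> (canonical_model, \<Delta> \<Turnstile> \<phi>) \<longleftrightarrow> \<phi> \<in> \<Delta>"
proof (induction \<phi> arbitrary: \<Delta>)
  case (Var n)
  then show ?case by (simp add: canonical_model_def)
next
  case Bot
  then show ?case by (simp add: prime_theory_def)
next
  case (Conj \<phi> \<psi>)
  have closed: "\<And>\<chi>. \<Delta> \<turnstile> \<chi> \<Longrightarrow> \<chi> \<in> \<Delta>" using Conj.prems by (simp add: prime_theory_def)
  have "(\<phi> \<^bold>\<and> \<psi>) \<in> \<Delta> \<longleftrightarrow> \<phi> \<in> \<Delta> \<and> \<psi> \<in> \<Delta>"
  proof (intro iffI conjI)
    assume "(\<phi> \<^bold>\<and> \<psi>) \<in> \<Delta>"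
    note conj = Hyp[OF this]
    show "\<phi> \<in> \<Delta>" by (rule closed[OF ModusPonens[OF conj ConjWeak]])
    show "\<psi> \<in> \<Delta>" by (rule closed[OF ModusPonens[OF conj conj_weak_right]])
  next
    assume "\<phi> \<in> \<Delta> \<and> \<psi> \<in> \<Delta>"
    then have "\<Delta> \<turnstile> \<phi>" "\<Delta> \<turnstile> \<psi>" by (simp_all add: Hyp)
    \<comment> \<open>Exporting the identity on the conjunction gives the pairing
      implication.\<close>
    then show "(\<phi> \<^bold>\<and> \<psi>) \<in> \<Delta>"
      by (intro closed) (rule ModusPonens[OF _ ModusPonens[OF _ Exportation[OF imp_refl]]])
  qed
  then show ?case using Conj by simp
next
  case (Disj \<phi> \<psi>)
  have closed: "\<And>\<chi>. \<Delta> \<turnstile> \<chi> \<Longrightarrow> \<chi> \<in> \<Delta>"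
    and prime: "(\<phi> \<^bold>\<or> \<psi>) \<in> \<Delta> \<Longrightarrow> \<phi> \<in> \<Delta> \<or> \<psi> \<in> \<Delta>"
    using Disj.prems by (simp_all add: prime_theory_def)
  have "(\<phi> \<^bold>\<or> \<psi>) \<in> \<Delta> \<longleftrightarrow> \<phi> \<in> \<Delta> \<or> \<psi> \<in> \<Delta>"
    using prime closed[OF ModusPonens[OF Hyp DisjWeak]]
      closed[OF ModusPonens[OF Hyp disj_weak_right]] by blast
  then show ?case using Disj by simp
next
  case (Imp \<phi> \<psi>)
  have closed: "\<And>\<chi>. \<Delta> \<turnstile> \<chi> \<Longrightarrow> \<chi> \<in> \<Delta>" using Imp.prems by (simp add: prime_theory_def)
  have "(canonical_model, \<Delta> \<Turnstile> \<phi> \<^bold>\<rightarrow> \<psi>) \<longleftrightarrow>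
      (\<forall>\<Theta>. prime_theory \<Theta> \<and> \<Delta> \<subseteq> \<Theta> \<and> \<phi> \<in> \<Theta> \<longrightarrow> \<psi> \<in> \<Theta>)"
    using Imp by (auto simp: canonical_model_def)
  also have "\<dots> \<longleftrightarrow> (\<phi> \<^bold>\<rightarrow> \<psi>) \<in> \<Delta>"
  proof
    assume all: "\<forall>\<Theta>. prime_theory \<Theta> \<and> \<Delta> \<subseteq> \<Theta> \<and> \<phi> \<in> \<Theta> \<longrightarrow> \<psi> \<in> \<Theta>"
    have "insert \<phi> \<Delta> \<turnstile> \<psi>"
    proof (rule ccontr)
      \<comment> \<open>A prime extension of \<open>insert \<phi> \<Delta>\<close> omitting
        \<open>\<psi>\<close> would be a successor of \<open>\<Delta>\<close> that contradicts
        \<open>all\<close>.\<close>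
      assume "\<not> insert \<phi> \<Delta> \<turnstile> \<psi>"
      then show False by (rule prime_extension) (use all in blast)
    qed
    then show "(\<phi> \<^bold>\<rightarrow> \<psi>) \<in> \<Delta>" by (intro closed deduction)
  next
    assume "(\<phi> \<^bold>\<rightarrow> \<psi>) \<in> \<Delta>"
    then show "\<forall>\<Theta>. prime_theory \<Theta> \<and> \<Delta> \<subseteq> \<Theta> \<and> \<phi> \<in> \<Theta> \<longrightarrow> \<psi> \<in> \<Theta>"
      unfolding prime_theory_def by (blast intro: Hyp ModusPonens)
  qed
  finally show ?case .
qed

lemma completeness:
  assumes "\<Gamma> \<Turnstile>\<^bsub>TYPE(form set)\<^esub> \<phi>"
  shows "\<Gamma> \<turnstile> \<phi>"
proof (rule ccontr)
  assume "\<not> \<Gamma> \<turnstile> \<phi>"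
  then obtain \<Delta> where \<Delta>: "\<Gamma> \<subseteq> \<Delta>" "prime_theory \<Delta>" "\<phi> \<notin> \<Delta>"
    by (rule prime_extension)
  have "\<Delta> \<in> worlds canonical_model" using \<Delta>(2) by (simp add: canonical_model_def)
  moreover have "\<forall>\<psi>\<in>\<Gamma>. canonical_model, \<Delta> \<Turnstile> \<psi>"
    using \<Delta> truth_canonical by blast
  ultimately have "canonical_model, \<Delta> \<Turnstile> \<phi>"
    using assms kripke_model_canonical[OF \<Delta>(2)] by (simp add: consequence_def)
  then show False using \<Delta> truth_canonical by blast
qed

(* The type 'w is arbitrary, so the second conjunct gives soundness over models with worlds in
   any type.  Truth in all Kripke models whatsoever implies truth in those with worlds in
   form set, so the first conjunct gives completeness. *)
theorem mainTheorem1: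
  fixes \<Gamma> :: "form set" and \<phi> :: form
  shows "(\<Gamma> \<turnstile> \<phi> \<longleftrightarrow> \<Gamma> \<Turnstile>\<^bsub>TYPE(form set)\<^esub> \<phi>) \<and> (\<Gamma> \<turnstile> \<phi> \<longrightarrow> \<Gamma> \<Turnstile>\<^bsub>TYPE('w)\<^esub> \<phi>)"
  by (rule conjI[OF iffI[OF soundness completeness] impI[OF soundness]])

end
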